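(* Let $A=[(\underline{a}_L,\overline{a}_L),(\underline{a}_U,\overline{a}_U)]$ and $B=[(\underline{b}_L,\overline{b}_L),(\underline{b}_U,\overline{b}_U)]$ be elements of $I_2(\mathbb{R})$. Then the generalised Hukuhara difference $A\ominus_g B$ is given by $A\ominus_g B=C=[(\underline{c}_L,\overline{c}_L),(\underline{c}_U,\overline{c}_U)]$, where $$\underline{c}_L=\min\{\underline{a}_L-\underline{b}_L,\ \overline{a}_U-\overline{b}_U\},\qquad \overline{c}_U=\max\{\underline{a}_L-\underline{b}_L,\ \overline{a}_U-\overline{b}_U\},$$ $$\overline{c}_L=\min\{\overline{a}_L-\overline{b}_L,\ \underline{a}_U-\underline{b}_U\},\qquad \underline{c}_U=\max\{\overline{a}_L-\overline{b}_L,\ \underline{a}_U-\underline{b}_U\}.$$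
   Context: A Type-2 interval is given by four real numbers $\underline{a}_L\le\overline{a}_L\le\underline{a}_U\le\overline{a}_U$ and is written $A=[(\underline{a}_L,\overline{a}_L),(\underline{a}_U,\overline{a}_U)]$; $I_2(\mathbb{R})$ denotes the set of all Type-2 intervals, with equality meaning equality of the four corresponding entries. Addition is entrywise: $A+B=[(\underline{a}_L+\underline{b}_L,\overline{a}_L+\overline{b}_L),(\underline{a}_U+\underline{b}_U,\overline{a}_U+\overline{b}_U)]$. For $\lambda\in\mathbb{R}$, $\lambda A$ is $[(\lambda\underline{a}_L,\lambda\overline{a}_L),(\lambda\underline{a}_U,\lambda\overline{a}_U)]$ if $\lambda\ge0$ and $[(\lambda\overline{a}_U,\lambda\underline{a}_U),(\lambda\overline{a}_L,\lambda\underline{a}_L)]$ if $\lambda<0$. The generalised Hukuhara difference is defined by: $A\ominus_g B=C$ if and only if (a) $A=B+C$ or (b) $B=A+(-1)C$.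
   Formalization: The formula is stated only for A, B whose generalised Hukuhara difference exists; it need not: for A=[(0,2),(2,4)], B=[(0,0),(1,1)] the entrywise differences 0,2,1,3 are not monotone, so no Type-2 interval C satisfies (a) or (b). *)

theory Defs
  imports Complex_Main
begin

text \<open>
  An element \<open>(p, q, r, s)\<close> is the interval written $[(p, q), (r, s)]$, that is,
  $p = \underline{a}_L$, $q = \overline{a}_L$, $r = \underline{a}_U$, $s = \overline{a}_U$.
\<close>

typedef type2_interval =
  "{(p :: real, q :: real, r :: real, s :: real). p \<le> q \<and> q \<le> r \<and> r \<le> s}"
  by auto

setup_lifting type_definition_type2_interval

lift_definition lower_L :: "type2_interval \<Rightarrow> real" is "\<lambda>(p, q, r, s). p" .
lift_definition upper_L :: "type2_interval \<Rightarrow> real" is "\<lambda>(p, q, r, s). q" .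
lift_definition lower_U :: "type2_interval \<Rightarrow> real" is "\<lambda>(p, q, r, s). r" .
lift_definition upper_U :: "type2_interval \<Rightarrow> real" is "\<lambda>(p, q, r, s). s" .

instantiation type2_interval :: plus
begin

lift_definition plus_type2_interval ::
    "type2_interval \<Rightarrow> type2_interval \<Rightarrow> type2_interval"
  is "\<lambda>(p, q, r, s) (p', q', r', s'). (p + p', q + q', r + r', s + s')"
  by (auto intro: add_mono)

instance ..

end

lift_definition scale :: "real \<Rightarrow> type2_interval \<Rightarrow> type2_interval"
  is "\<lambda>c (p, q, r, s).
        if c \<ge> 0 then (c * p, c * q, c * r, c * s) else (c * s, c * r, c * q, c * p)"
  by (auto intro: mult_left_mono mult_left_mono_neg split: if_splits)

text \<open>
  \<open>is_gH_diff A B C\<close> is the relation $A \ominus_g B = C$. It is kept as a relation because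
  $\ominus_g$ is only a partial operation; see the example below.
\<close>

definition is_gH_diff :: "type2_interval \<Rightarrow> type2_interval \<Rightarrow> type2_interval \<Rightarrow> bool" where
  "is_gH_diff A B C \<longleftrightarrow> A = B + C \<or> B = A + scale (- 1) C"

text \<open>
  $[(0, 2), (2, 4)] \ominus_g [(0, 0), (1, 1)]$ does not exist: the differences of corresponding
  entries are $0, 2, 1, 3$, which are neither weakly increasing nor weakly decreasing.
\<close>

lemma gH_diff_may_not_exist: "\<exists>A B. \<nexists>C. is_gH_diff A B C"
proof -
  have "\<not> is_gH_diff (Abs_type2_interval (0, 2, 2, 4)) (Abs_type2_interval (0, 0, 1, 1)) C" for C
    unfolding is_gH_diff_def
    by (cases C)
      (auto simp: plus_type2_interval.abs_eq scale.abs_eq eq_onp_def Abs_type2_interval_inject)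
  then show ?thesis by blast
qed

end

theory Submission
  imports Defs
begin

text \<open>
  Entrywise, (a) says that \<open>C\<close> lists the four differences of corresponding entries of \<open>A\<close> and \<open>B\<close>
  in order, and (b) that it lists them in reverse. As the entries of \<open>C\<close> are weakly increasing,
  the differences are monotone one way or the other, so minima and maxima sort the outer and the
  inner pair. If both alternatives occur, then all four differences coincide.
\<close>

lemma type2_interval_eq_iff:
  "A = B \<longleftrightarrow> lower_L A = lower_L B \<and> upper_L A = upper_L B \<and>
    lower_U A = lower_U B \<and> upper_U A = upper_U B"
  by transfer auto

lemma type2_interval_ordered:
  "lower_L A \<le> upper_L A" "upper_L A \<le> lower_U A" "lower_U A \<le> upper_U A"
  by (transfer; auto)+

lemma entries_plus [simp]:
  "lower_L (A + B) = lower_L A + lower_L B"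
  "upper_L (A + B) = upper_L A + upper_L B"
  "lower_U (A + B) = lower_U A + lower_U B"
  "upper_U (A + B) = upper_U A + upper_U B"
  by (transfer; auto)+

lemma entries_scale_minus_one [simp]:
  "lower_L (scale (- 1) A) = - upper_U A"
  "upper_L (scale (- 1) A) = - lower_U A"
  "lower_U (scale (- 1) A) = - upper_L A"
  "upper_U (scale (- 1) A) = - lower_L A"
  by (transfer; auto)+

text \<open>Existence has to be assumed: for [(0, 2), (2, 4)] and [(0, 0), (1, 1)] the formulas
  yield the interval [(0, 1), (2, 3)], yet no difference exists. The equivalence also gives
  uniqueness.\<close>

theorem proposition6p1:
  fixes A B C :: type2_interval
  assumes "\<exists>D. is_gH_diff A B D"
  shows "is_gH_diff A B C \<longleftrightarrow>
    lower_L C = min (lower_L A - lower_L B) (upper_U A - upper_U B) \<and>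
    upper_U C = max (lower_L A - lower_L B) (upper_U A - upper_U B) \<and>
    upper_L C = min (upper_L A - upper_L B) (lower_U A - lower_U B) \<and>
    lower_U C = max (upper_L A - upper_L B) (lower_U A - lower_U B)"
proof -
  \<comment> \<open>For the forward direction the order of the entries of \<open>C\<close> suffices.
    For the converse, that of \<open>D\<close> makes the differences monotone, so the formulas force
    \<open>C = D\<close>.\<close>
  obtain D where "is_gH_diff A B D"
    using assms by blast
  then show ?thesis
    using type2_interval_ordered[of C] type2_interval_ordered[of D]
    unfolding is_gH_diff_def type2_interval_eq_iff entries_plus entries_scale_minus_one
      min_def max_def
    by (smt (verit))
qed

end
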